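(* Let $k\ge2$ and let $S^k$ be the $k$-uniform sunflower hypergraph. Then the spectrum of its Seidel matrix is $$\sigma_S(S^k)=\begin{pmatrix}1 & 2-k+\sqrt{(k+3)(k-1)} & 2-k-\sqrt{(k+3)(k-1)} & r_1 & r_2 & r_3\\ (k-1)(k-2) & k-2 & k-2 & 1&1&1\end{pmatrix},$$ where $r_1,r_2,r_3$ are the roots (with multiplicity) of the equation $$\lambda^3-(6-5k+k^2)\lambda^2-(-17+26k-12k^2+2k^3)\lambda-8+17k-11k^2+2k^3=0.$$
   Context: A hypergraph $G^*=(V,E)$ has a finite vertex set $V=\{v_1,\dots,v_N\}$ and a finite set $E$ of hyperedges, each a subset of $V$. Its adjacency matrix $A=(a_{ij})$ has $a_{ij}=|\{e\in E:\{v_i,v_j\}\subset e\}|$ for $i\ne j$ and $a_{ii}=0$. Its Seidel matrix is $S=J_N-I_N-2A$ ($J_N$ all-ones matrix, $I_N$ identity). The sunflower hypergraph $S^k$ is the $k$-uniform hypergraph of order $k(k-1)+1$ with vertices $v_{0,0}$ and $v_{i,j}$ ($1\le i\le k-1$, $1\le j\le k$) and hyperedges $\{v_{i,1},v_{i,2},\dots,v_{i,k}\}$ for $1\le i\le k-1$ together with $\{v_{0,0},v_{1,1},v_{2,1},\dots,v_{k-1,1}\}$. The two-row notation for a spectrum lists eigenvalues in the first row and multiplicities in the second; it is read as a multiset (if listed values coincide, their multiplicities add, and multiplicity $0$ means the entry is absent). *)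

theory Defs
  imports
    Complex_Main
    "HOL-Computational_Algebra.Fundamental_Theorem_Algebra"
    "Jordan_Normal_Form.Char_Poly"
begin

record 'a hypergraph =
  verts :: "'a set"
  edges :: "'a set set"

definition is_hypergraph :: "'a hypergraph \<Rightarrow> bool" where
  "is_hypergraph H \<longleftrightarrow> finite (verts H) \<and> (\<forall>e \<in> edges H. e \<subseteq> verts H)"

definition uniform :: "nat \<Rightarrow> 'a hypergraph \<Rightarrow> bool" where
  "uniform k H \<longleftrightarrow> (\<forall>e \<in> edges H. card e = k)"

(* A list vs enumerating the vertices (distinct, with set vs = verts H) fixes the order of the
   rows and columns. *)
definition adjacency_mat :: "'a hypergraph \<Rightarrow> 'a list \<Rightarrow> real mat" where
  "adjacency_mat H vs = mat (length vs) (length vs) (\<lambda>(i, j).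
     if i = j then 0 else real (card {e \<in> edges H. {vs ! i, vs ! j} \<subseteq> e}))"

definition seidel_mat :: "'a hypergraph \<Rightarrow> 'a list \<Rightarrow> real mat" where
  "seidel_mat H vs =
     mat (length vs) (length vs) (\<lambda>_. 1) - 1\<^sub>m (length vs) - 2 \<cdot>\<^sub>m adjacency_mat H vs"

(* All complex eigenvalues, with algebraic multiplicities; for the symmetric matrices considered
   here these are also the geometric multiplicities. *)
definition mat_spectrum :: "real mat \<Rightarrow> complex multiset" where
  "mat_spectrum A = proots (char_poly (map_mat complex_of_real A))"

(* The pair (i, j) stands for the vertex v_{i,j}. *)
definition sunflower :: "nat \<Rightarrow> (nat \<times> nat) hypergraph" where
  "sunflower k =
     \<lparr> verts = insert (0, 0) ({1..k - 1} \<times> {1..k}),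
       edges = insert (insert (0, 0) {(i, 1) | i. i \<in> {1..k - 1}})
                 {{(i, j) | j. j \<in> {1..k}} | i. i \<in> {1..k - 1}} \<rparr>"

lemma is_hypergraph_sunflower: "k \<ge> 2 \<Longrightarrow> is_hypergraph (sunflower k)"
  by (auto simp: is_hypergraph_def sunflower_def)

lemma order_sunflower: "card (verts (sunflower k)) = k * (k - 1) + 1"
  by (simp add: sunflower_def card_insert_if card_cartesian_product)

lemma uniform_sunflower:
  assumes "k \<ge> 2"
  shows "uniform k (sunflower k)"
proof -
  have "{(i, j) | j. j \<in> {1..k}} = Pair i ` {1..k}" for i :: nat
    by auto
  then have petal: "card {(i, j) | j. j \<in> {1..k}} = k" for i :: nat
    by (simp add: card_image inj_on_def)
  have "{(i, 1 :: nat) | i. i \<in> {1..k - 1}} = (\<lambda>i. (i, 1)) ` {1..k - 1}"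
    by auto
  then have "card (insert (0, 0) {(i, 1 :: nat) | i. i \<in> {1..k - 1}}) = k"
    using assms by (simp add: card_insert_if card_image inj_on_def image_iff)
  with petal show ?thesis
    by (auto simp: uniform_def sunflower_def)
qed

end

theory Submission
  imports Defs
begin

text \<open>
  Let \<open>n = k - 1\<close> be the number of petals. The Seidel matrix has three kinds of invariant subspaces:
  differences of two outer vertices of the same petal are eigenvectors for the eigenvalue 1; vectors
  with the value \<open>x i\<close> at the core vertex and \<open>r * x i\<close> at the outer vertices of petal \<open>i\<close>, where
  \<open>x\<close> has sum 0, are eigenvectors for the two quadratic eigenvalues, for suitable ratios \<open>r\<close>; and
  the vectors invariant under all symmetries form a 3-dimensional subspace on which the
  characteristic polynomial is the cubic of the theorem. In a basis adapted to this decomposition the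
  matrix is block diagonal, and the base change is invertible.
\<close>

section \<open>Matrices labelled by lists, and similarity through a change of basis\<close>

text \<open>Rows and columns are labelled by list elements, so that for distinct labels a matrix
  product becomes a sum over a set and the order of enumeration stops mattering.\<close>

definition fun_mat :: "('a \<Rightarrow> 'b \<Rightarrow> 'c) \<Rightarrow> 'a list \<Rightarrow> 'b list \<Rightarrow> 'c mat" where
  "fun_mat f us ws = mat (length us) (length ws) (\<lambda>(i, j). f (us ! i) (ws ! j))"

lemma fun_mat_carrier [simp]: "fun_mat f us ws \<in> carrier_mat (length us) (length ws)"
  by (simp add: fun_mat_def)

lemma sum_nth_distinct:
  assumes "distinct xs"
  shows "(\<Sum>i = 0..<length xs. f (xs ! i)) = (\<Sum>x\<in>set xs. f x)"
  using sum.reindex_bij_betw[OF bij_betw_nth[OF assms refl refl], of f]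
  by (simp add: atLeast0LessThan)

lemma fun_mat_mult:
  assumes "distinct ws"
  shows "fun_mat f us ws * fun_mat g ws xs = fun_mat (\<lambda>u x. \<Sum>w\<in>set ws. f u w * g w x) us xs"
  by (rule eq_matI)
    (simp_all add: fun_mat_def scalar_prod_def
      sum_nth_distinct[OF assms, where f = "\<lambda>w. f _ w * g w _"])

text \<open>A nonzero determinant makes \<open>P\<close> invertible, and the relation
  \<open>A * P = P * B\<close> then becomes a similarity.\<close>

lemma char_poly_eq_if_intertwined:
  fixes A B P :: "'a :: field mat"
  assumes A: "A \<in> carrier_mat n n" and B: "B \<in> carrier_mat n n" and P: "P \<in> carrier_mat n n"
    and AP: "A * P = P * B" and det: "det P \<noteq> 0"
  shows "char_poly A = char_poly B"
proof -
  from det_non_zero_imp_unit[OF P det, of "()"] obtain Q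
    where Q: "Q \<in> carrier_mat n n" "P * Q = 1\<^sub>m n" "Q * P = 1\<^sub>m n"
    by (auto simp: Units_def ring_mat_simps)
  have "P * B * Q = A * (P * Q)"
    using assoc_mult_mat[OF A P Q(1)] AP by simp
  then have "A = P * B * Q"
    using Q A by simp
  then have "similar_mat A B"
    unfolding similar_mat_def similar_mat_wit_def Let_def
    using A B P Q by (intro exI[of _ P] exI[of _ Q]) auto
  then show ?thesis
    by (rule char_poly_similar)
qed

text \<open>Injectivity of the base change replaces an explicit inverse: between spaces of equal
  dimension, a trivial kernel already gives a nonzero determinant.\<close>

lemma char_poly_fun_mat_eq:
  fixes s :: "'a \<Rightarrow> 'a \<Rightarrow> 'c :: field" and p :: "'a \<Rightarrow> 'b \<Rightarrow> 'c" and b :: "'b \<Rightarrow> 'b \<Rightarrow> 'c"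
  assumes "distinct us" and "distinct ws" and len: "length us = length ws"
    and comm: "\<And>u w. u \<in> set us \<Longrightarrow> w \<in> set ws \<Longrightarrow>
      (\<Sum>x\<in>set us. s u x * p x w) = (\<Sum>x\<in>set ws. p u x * b x w)"
    and inj: "\<And>v x. (\<And>u. u \<in> set us \<Longrightarrow> (\<Sum>x\<in>set ws. p u x * v x) = 0) \<Longrightarrow> x \<in> set ws \<Longrightarrow> v x = 0"
  shows "char_poly (fun_mat s us us) = char_poly (fun_mat b ws ws)"
proof (rule char_poly_eq_if_intertwined)
  let ?n = "length us"
  let ?P = "fun_mat p us ws"
  show "fun_mat s us us \<in> carrier_mat ?n ?n" "fun_mat b ws ws \<in> carrier_mat ?n ?n"
    and P: "?P \<in> carrier_mat ?n ?n"
    by (simp_all add: len fun_mat_def)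
  show "fun_mat s us us * ?P = ?P * fun_mat b ws ws"
    unfolding fun_mat_mult[OF assms(1)] fun_mat_mult[OF assms(2)]
    by (rule eq_matI) (simp_all add: fun_mat_def comm)
  show "det ?P \<noteq> 0"
  proof
    assume "det ?P = 0"
    then obtain v where v: "v \<in> carrier_vec ?n" "v \<noteq> 0\<^sub>v ?n" "?P *\<^sub>v v = 0\<^sub>v ?n"
      unfolding det_0_iff_vec_prod_zero_field[OF P] by blast
    \<comment> \<open>The kernel vector becomes a function on labels; distinctness of
      \<open>ws\<close> makes the position described by \<open>THE\<close> unique.\<close>
    define f where "f = (\<lambda>x. v $ (THE i. i < ?n \<and> ws ! i = x))"
    have f: "f (ws ! i) = v $ i" if "i < ?n" for i
    proof -
      have "(THE j. j < ?n \<and> ws ! j = ws ! i) = i"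
        using that \<open>distinct ws\<close> len by (intro the_equality) (auto simp: nth_eq_iff_index_eq)
      then show ?thesis by (simp add: f_def)
    qed
    have "(\<Sum>x\<in>set ws. p u x * f x) = 0" if "u \<in> set us" for u
    proof -
      from that obtain i where i: "i < ?n" "us ! i = u"
        by (auto simp: in_set_conv_nth)
      have "(\<Sum>x\<in>set ws. p u x * f x) = (\<Sum>j = 0..<length ws. p u (ws ! j) * f (ws ! j))"
        using sum_nth_distinct[OF \<open>distinct ws\<close>, of "\<lambda>x. p u x * f x"] by simp
      also have "\<dots> = (?P *\<^sub>v v) $ i"
        using i v(1) len by (auto simp: fun_mat_def scalar_prod_def f intro!: sum.cong)
      finally show ?thesis
        using v(3) i by simp
    qed
    then have "f x = 0" if "x \<in> set ws" for x
      using inj that by blast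
    then have "v = 0\<^sub>v ?n"
      using v(1) len f by (intro eq_vecI) (auto dest: nth_mem simp flip: f)
    with v(2) show False ..
  qed
qed

section \<open>Block diagonal and 3 by 3 characteristic polynomials, roots of products\<close>

text \<open>The characteristic matrix inherits the block structure, so its determinant factors; the
  second block is diagonal and contributes the linear factors.\<close>

lemma char_poly_block_diagonal:
  fixes b :: "'a \<Rightarrow> 'a \<Rightarrow> complex"
  assumes dist: "distinct (us @ ws)"
    and diag: "\<And>x w. x \<in> set (us @ ws) \<Longrightarrow> w \<in> set ws \<Longrightarrow> b x w = (if x = w then l w else 0)"
    and zero: "\<And>x w. x \<in> set ws \<Longrightarrow> w \<in> set us \<Longrightarrow> b x w = 0"
  shows "char_poly (fun_mat b (us @ ws) (us @ ws)) =
    char_poly (fun_mat b us us) * (\<Prod>w\<leftarrow>ws. [:- l w, 1:])"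
proof -
  let ?n = "length us" and ?m = "length ws"
  let ?U = "fun_mat b us us" and ?D = "fun_mat b ws ws"
  have ut: "upper_triangular ?D"
    using dist diag by (auto simp: upper_triangular_def fun_mat_def nth_eq_iff_index_eq)
  have D: "char_poly ?D = (\<Prod>w\<leftarrow>ws. [:- l w, 1:])"
  proof -
    have "diag_mat ?D = map l ws"
      using diag by (auto simp: diag_mat_def fun_mat_def intro!: nth_equalityI)
    then show ?thesis
      unfolding char_poly_upper_triangular[OF fun_mat_carrier ut] by (simp add: comp_def)
  qed
  have "char_poly_matrix (fun_mat b (us @ ws) (us @ ws)) =
    four_block_mat (char_poly_matrix ?U) (0\<^sub>m ?n ?m) (0\<^sub>m ?m ?n) (char_poly_matrix ?D)"
  proof (rule eq_matI, goal_cases)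
    case (1 i j)
    \<comment> \<open>By \<open>diag\<close>, an entry of the upper right block vanishes when its
      row and column labels differ; distinctness of \<open>us @ ws\<close> guarantees this.\<close>
    have "us ! i \<noteq> ws ! j'" if "i < ?n" "j' < ?m" for i j'
      using dist that nth_mem[of i us] nth_mem[of j' ws] by (metis disjoint_iff distinct_append)
    moreover have "i - ?n = j - ?n \<longleftrightarrow> i = j" if "i \<ge> ?n" "j \<ge> ?n"
      using that by auto
    ultimately show ?case
      using 1 diag zero
      by (auto simp: char_poly_matrix_def fun_mat_def nth_append)
  qed (auto simp: char_poly_matrix_def fun_mat_def)
  then have "char_poly (fun_mat b (us @ ws) (us @ ws)) = char_poly ?U * char_poly ?D"
    unfolding char_poly_def
    by (simp add: det_four_block_mat_lower_left_zero[of _ ?n _ ?m])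
  then show ?thesis
    using D by simp
qed

lemma det_3:
  fixes A :: "'a :: comm_ring_1 mat"
  assumes A: "A \<in> carrier_mat 3 3"
  shows "det A = A $$ (0,0) * (A $$ (1,1) * A $$ (2,2) - A $$ (1,2) * A $$ (2,1))
    - A $$ (1,0) * (A $$ (0,1) * A $$ (2,2) - A $$ (0,2) * A $$ (2,1))
    + A $$ (2,0) * (A $$ (0,1) * A $$ (1,2) - A $$ (0,2) * A $$ (1,1))"
proof -
  have det2: "det B = B $$ (0,0) * B $$ (1,1) - B $$ (1,0) * B $$ (0,1)"
    if "B \<in> carrier_mat 2 2" for B :: "'a mat"
    using that by (subst laplace_expansion_column[OF that, of 0])
      (auto simp: cofactor_def numeral_2_eq_2 det_single mat_delete_def)
  have "mat_delete A i 0 \<in> carrier_mat 2 2" for i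
    using mat_delete_carrier[of A 3 3 i 0] A by simp
  then show ?thesis
    using A by (subst laplace_expansion_column[OF A, of 0])
      (auto simp: cofactor_def det2 eval_nat_numeral mat_delete_def algebra_simps)
qed

lemma proots_prod_linear_factors:
  fixes l :: "'a \<Rightarrow> 'b :: idom"
  shows "proots (\<Prod>w\<leftarrow>ws. [:- l w, 1:]) = image_mset l (mset ws)"
proof (induction ws)
  case (Cons w ws)
  have "(\<Prod>w\<leftarrow>ws. [:- l w, 1:]) \<noteq> 0"
    by (auto simp: prod_list_zero_iff)
  then show ?case
    using Cons by (simp add: proots_mult del: mult_pCons_left)
qed simp

text \<open>Singles out the one petal or vertex that deviates from the generic rule.\<close>

lemma sum_if_eq:
  fixes g h :: "'a \<Rightarrow> 'b :: ab_group_add"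
  assumes "finite A" and "a \<in> A"
  shows "(\<Sum>x\<in>A. if x = a then g x else h x) = g a - h a + (\<Sum>x\<in>A. h x)"
  using assms by (simp add: sum.remove[of A a])

section \<open>Entries of the Seidel matrix of the sunflower\<close>

text \<open>Off the diagonal, an entry is 1 minus twice the number of common edges. For distinct
  vertices, equal first coordinates mean a common petal; second coordinate at most 1 means lying on
  the edge through \<open>(0, 0)\<close>.\<close>

definition seidel_entry :: "nat \<times> nat \<Rightarrow> nat \<times> nat \<Rightarrow> complex" where
  "seidel_entry u w =
    (if u = w then 0 else if fst u = fst w \<or> (snd u \<le> 1 \<and> snd w \<le> 1) then -1 else 1)"

text \<open>Petals are pairwise disjoint and the edge through \<open>(0, 0)\<close> meets each of
  them in one vertex, so distinct vertices share at most one edge.\<close>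

lemma card_common_edges_sunflower:
  assumes "k \<ge> 2" and u: "u \<in> verts (sunflower k)" and w: "w \<in> verts (sunflower k)" and "u \<noteq> w"
  shows "card {e \<in> edges (sunflower k). {u, w} \<subseteq> e} =
    (if fst u = fst w \<or> (snd u \<le> 1 \<and> snd w \<le> 1) then 1 else 0)"
proof -
  define C where "C = insert (0, 0) {(i, 1 :: nat) | i. i \<in> {1..k - 1}}"
  define P where "P = (\<lambda>i :: nat. {(i, j) | j. j \<in> {1..k}})"
  have E: "edges (sunflower k) = insert C (P ` {1..k - 1})"
    by (auto simp: sunflower_def C_def P_def)
  have V: "v = (0, 0) \<or> (fst v \<in> {1..k - 1} \<and> snd v \<in> {1..k})" if "v \<in> verts (sunflower k)" for v
    using that by (auto simp: sunflower_def)
  have C: "v \<in> C \<longleftrightarrow> snd v \<le> 1" if "v \<in> verts (sunflower k)" for v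
    using V[OF that] by (cases v) (auto simp: C_def)
  have P: "v \<in> P i \<longleftrightarrow> fst v = i" if "v \<in> verts (sunflower k)" "i \<ge> 1" for v i
    using V[OF that(1)] that(2) by (cases v) (auto simp: P_def)
  consider "fst u = fst w" | "fst u \<noteq> fst w" "snd u \<le> 1 \<and> snd w \<le> 1"
    | "fst u \<noteq> fst w" "\<not> (snd u \<le> 1 \<and> snd w \<le> 1)"
    by blast
  then show ?thesis
  proof cases
    case 1
    \<comment> \<open>Only \<open>(0, 0)\<close> has first coordinate 0, so both vertices lie in a
      petal; and only one vertex of a petal lies in \<open>C\<close>.\<close>
    then have "fst u \<in> {1..k - 1}" "\<not> (snd u \<le> 1 \<and> snd w \<le> 1)"
      using V[OF u] V[OF w] \<open>u \<noteq> w\<close> by (auto simp: prod_eq_iff)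
    then have "{e \<in> edges (sunflower k). {u, w} \<subseteq> e} = {P (fst u)}"
      using 1 C[OF u] C[OF w] P[OF u] P[OF w] by (auto simp: E)
    then show ?thesis
      using 1 by simp
  next
    case 2
    then have "{e \<in> edges (sunflower k). {u, w} \<subseteq> e} = {C}"
      using C[OF u] C[OF w] P[OF u] P[OF w] by (auto simp: E)
    then show ?thesis
      using 2 by simp
  next
    case 3
    then have "{e \<in> edges (sunflower k). {u, w} \<subseteq> e} = {}"
      using C[OF u] C[OF w] P[OF u] P[OF w] by (auto simp: E)
    then show ?thesis
      using 3 by (simp only: card.empty if_False if_True simp_thms)
  qed
qed

lemma seidel_mat_sunflower:
  assumes "k \<ge> 2" and "distinct vs" and "set vs = verts (sunflower k)"
  shows "map_mat complex_of_real (seidel_mat (sunflower k) vs) = fun_mat seidel_entry vs vs"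
proof (rule eq_matI, goal_cases)
  case (1 i j)
  then have ij: "i < length vs" "j < length vs"
    by (simp_all add: fun_mat_def)
  then have "vs ! i = vs ! j \<longleftrightarrow> i = j"
    using assms(2) by (simp add: nth_eq_iff_index_eq)
  moreover have "vs ! i \<in> verts (sunflower k)" "vs ! j \<in> verts (sunflower k)"
    using ij assms(3) by (metis nth_mem)+
  ultimately show ?case
    using ij card_common_edges_sunflower[OF assms(1), of "vs ! i" "vs ! j"]
    by (auto simp: seidel_mat_def adjacency_mat_def fun_mat_def seidel_entry_def)
qed (simp_all add: seidel_mat_def adjacency_mat_def fun_mat_def)

section \<open>Rows of the Seidel matrix applied to a vector\<close>

lemma sum_verts_sunflower:
  assumes "k \<ge> 2"
  shows "(\<Sum>x\<in>verts (sunflower k). f x) =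
    f (0, 0) + (\<Sum>i = 1..k - 1. f (i, 1) + (\<Sum>j = 2..k. f (i, j)))"
proof -
  have "(\<Sum>x\<in>verts (sunflower k). f x) = f (0, 0) + (\<Sum>i = 1..k - 1. \<Sum>j = 1..k. f (i, j))"
    by (simp add: sunflower_def sum.cartesian_product)
  also have "\<dots> = f (0, 0) + (\<Sum>i = 1..k - 1. f (i, 1) + (\<Sum>j = 2..k. f (i, j)))"
    using assms by (simp add: sum.atLeast_Suc_atMost numeral_2_eq_2)
  finally show ?thesis .
qed

lemma seidel_entry_center:
  assumes "k \<ge> 2"
  shows "(\<Sum>x\<in>verts (sunflower k). seidel_entry (0, 0) x * f x) =
    (\<Sum>i = 1..k - 1. (\<Sum>j = 2..k. f (i, j)) - f (i, 1))"
  unfolding sum_verts_sunflower[OF assms]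
  by (auto simp: seidel_entry_def intro!: sum.cong)

text \<open>The last sum treats all petals alike, with entry 1 at outer and -1 at core vertices.
  Petal \<open>i\<close> really contributes minus its outer sum; the first two terms are the
  correction.\<close>

lemma seidel_entry_core:
  assumes "k \<ge> 2" and i: "i \<in> {1..k - 1}"
  shows "(\<Sum>x\<in>verts (sunflower k). seidel_entry (i, 1) x * f x) =
    f (i, 1) - 2 * (\<Sum>j = 2..k. f (i, j)) - f (0, 0)
    + (\<Sum>i' = 1..k - 1. (\<Sum>j = 2..k. f (i', j)) - f (i', 1))"
proof -
  have "seidel_entry (i, 1) (i', 1) * f (i', 1) + (\<Sum>j = 2..k. seidel_entry (i, 1) (i', j) * f (i', j)) =
    (if i' = i then - (\<Sum>j = 2..k. f (i', j)) else (\<Sum>j = 2..k. f (i', j)) - f (i', 1))" for i'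
    by (auto simp: seidel_entry_def sum_negf[symmetric] intro!: sum.cong)
  then show ?thesis
    unfolding sum_verts_sunflower[OF assms(1)]
    using i by (simp add: sum_if_eq) (simp add: seidel_entry_def)
qed

text \<open>Here every petal first counts with entry 1 throughout. Inside petal \<open>i\<close> the
  entries are -1 off the diagonal and 0 on it, which costs twice the petal sum and gives back
  \<open>f (i, j)\<close>.\<close>

lemma seidel_entry_outer:
  assumes "k \<ge> 2" and i: "i \<in> {1..k - 1}" and j: "j \<in> {2..k}"
  shows "(\<Sum>x\<in>verts (sunflower k). seidel_entry (i, j) x * f x) =
    f (0, 0) + f (i, j) - 2 * f (i, 1) - 2 * (\<Sum>j = 2..k. f (i, j))
    + (\<Sum>i' = 1..k - 1. (\<Sum>j = 2..k. f (i', j)) + f (i', 1))"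
proof -
  have inner: "(\<Sum>j' = 2..k. seidel_entry (i, j) (i', j') * f (i', j')) =
      (if i' = i then f (i, j) - (\<Sum>j = 2..k. f (i', j)) else (\<Sum>j = 2..k. f (i', j)))" for i'
  proof (cases "i' = i")
    case True
    have "(\<Sum>j' = 2..k. seidel_entry (i, j) (i, j') * f (i, j')) =
        (\<Sum>j' = 2..k. if j' = j then 0 else - f (i, j'))"
      by (auto simp: seidel_entry_def intro!: sum.cong)
    also have "\<dots> = f (i, j) - (\<Sum>j = 2..k. f (i, j))"
      using j by (simp add: sum_if_eq sum_negf)
    finally show ?thesis
      using True by simp
  qed (use j in \<open>auto simp: seidel_entry_def intro!: sum.cong\<close>)
  have "seidel_entry (i, j) (i', 1) * f (i', 1) +
      (\<Sum>j' = 2..k. seidel_entry (i, j) (i', j') * f (i', j')) =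
    (if i' = i then f (i, j) - f (i', 1) - (\<Sum>j = 2..k. f (i', j))
      else (\<Sum>j = 2..k. f (i', j)) + f (i', 1))" for i'
    unfolding inner using j by (auto simp: seidel_entry_def)
  then show ?thesis
    unfolding sum_verts_sunflower[OF assms(1)]
    using i j by (simp add: sum_if_eq) (simp add: seidel_entry_def)
qed

section \<open>The basis adapted to the symmetries\<close>

text \<open>
  The basis vectors are indexed by the vertices themselves: \<open>(0, 0)\<close>, \<open>(1, 1)\<close>, \<open>(1, 2)\<close> index the three
  symmetric vectors, \<open>(i, 1)\<close> and \<open>(i, 2)\<close> with \<open>i \<ge> 2\<close> the eigenvectors supported on petals \<open>i\<close> and 1 for
  the two quadratic eigenvalues, and \<open>(i, j)\<close> with \<open>j \<ge> 3\<close> the difference of \<open>(i, j)\<close> and \<open>(i, 2)\<close>.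
\<close>

definition eigval :: "nat \<Rightarrow> nat \<times> nat \<Rightarrow> complex" where
  "eigval k w =
    (if snd w = 1 then complex_of_real (2 - real k + sqrt ((real k + 3) * (real k - 1)))
     else if snd w = 2 then complex_of_real (2 - real k - sqrt ((real k + 3) * (real k - 1)))
     else 1)"

text \<open>For petal weights with sum 0, the core row of the eigenvector equation reads 1 - 2 (k -
  1) r = \<lambda>; this is its solution r.\<close>

definition eigvec_ratio :: "nat \<Rightarrow> nat \<times> nat \<Rightarrow> complex" where
  "eigvec_ratio k w = (1 - eigval k w) / (2 * (of_nat k - 1))"

definition basis_vec :: "nat \<Rightarrow> nat \<times> nat \<Rightarrow> nat \<times> nat \<Rightarrow> complex" where
  "basis_vec k u w =
    (if w = (0, 0) then of_bool (u = (0, 0))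
     else if w = (1, 1) then of_bool (snd u = 1)
     else if w = (1, 2) then of_bool (snd u \<ge> 2)
     else if snd w \<le> 2 then
       (if fst u = fst w then 1 else if fst u = 1 then -1 else 0)
         * (if snd u = 1 then 1 else eigvec_ratio k w)
     else if fst u = fst w then of_bool (snd u = snd w) - of_bool (snd u = 2)
     else 0)"

abbreviation symmetric_indices :: "(nat \<times> nat) list" where
  "symmetric_indices \<equiv> [(0, 0), (1, 1), (1, 2)]"

text \<open>Quotient matrix of the partition into center, core and outer vertices: the sum of a
  Seidel row of class \<open>snd x\<close> over the class \<open>snd w\<close>. There are
  \<open>n\<close> petals, each with \<open>n\<close> outer vertices.\<close>

definition quotient_entry :: "nat \<Rightarrow> nat \<times> nat \<Rightarrow> nat \<times> nat \<Rightarrow> complex" where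
  "quotient_entry k x w = (let n = of_nat k - 1 in
    (if snd x = 0 then (if snd w = 0 then 0 else if snd w = 1 then - n else n ^ 2)
     else if snd x = 1 then (if snd w = 0 then - 1 else if snd w = 1 then 1 - n else n ^ 2 - 2 * n)
     else (if snd w = 0 then 1 else if snd w = 1 then n - 2 else (n - 1) ^ 2)))"

definition block_entry :: "nat \<Rightarrow> nat \<times> nat \<Rightarrow> nat \<times> nat \<Rightarrow> complex" where
  "block_entry k x w =
    (if w \<in> set symmetric_indices then of_bool (x \<in> set symmetric_indices) * quotient_entry k x w
     else of_bool (x = w) * eigval k w)"

text \<open>The core row and, after substituting it, the outer row of the eigenvector equation.
  Given the first, the second amounts to the quadratic equation of the eigenvalue.\<close>

lemma eigvec_ratio_eqs:
  assumes "k \<ge> 2" and "snd w = 1 \<or> snd w = 2"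
  shows "2 * (of_nat k - 1) * eigvec_ratio k w = 1 - eigval k w"
    and "(eigval k w - 1) * eigvec_ratio k w = eigval k w - 3"
proof -
  have k: "(of_nat k :: complex) - 1 \<noteq> 0"
    using assms(1) of_nat_eq_iff[of k 1, where 'a = complex] by simp
  then show 1: "2 * (of_nat k - 1) * eigvec_ratio k w = 1 - eigval k w"
    by (simp add: eigvec_ratio_def)
  define r where "r = complex_of_real (sqrt ((real k + 3) * (real k - 1)))"
  have "r ^ 2 = complex_of_real ((sqrt ((real k + 3) * (real k - 1))) ^ 2)"
    by (simp add: r_def)
  also have "\<dots> = (of_nat k + 3) * (of_nat k - 1)"
    using assms(1) by simp
  finally have r: "r ^ 2 = (of_nat k + 3) * (of_nat k - 1)" .
  have "eigval k w = 2 - of_nat k + r \<or> eigval k w = 2 - of_nat k - r"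
    using assms(2) by (auto simp: eigval_def r_def)
  \<comment> \<open>Squaring removes the choice of sign, so both eigenvalues are handled at
    once.\<close>
  then have "(eigval k w - 2 + of_nat k) ^ 2 = r ^ 2"
    by auto
  then have "(1 - eigval k w) ^ 2 = 2 * (of_nat k - 1) * (3 - eigval k w)"
    unfolding r by (simp add: power2_eq_square algebra_simps)
  moreover have "2 * (of_nat k - 1) * ((eigval k w - 1) * eigvec_ratio k w) =
      (eigval k w - 1) * (2 * (of_nat k - 1) * eigvec_ratio k w)"
    by simp
  then have "2 * (of_nat k - 1) * ((eigval k w - 1) * eigvec_ratio k w) = - ((1 - eigval k w) ^ 2)"
    unfolding 1 by (simp add: power2_eq_square algebra_simps)
  ultimately have "2 * (of_nat k - 1) * ((eigval k w - 1) * eigvec_ratio k w) =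
      2 * (of_nat k - 1) * (eigval k w - 3)"
    by (simp flip: mult_minus_right)
  then show "(eigval k w - 1) * eigvec_ratio k w = eigval k w - 3"
    using k by simp
qed

section \<open>The Seidel matrix in the adapted basis\<close>

text \<open>A row sees a vector only through its value at \<open>(0, 0)\<close>, the core value and
  the outer sum of each petal, and, for outer \<open>u\<close>, the value \<open>f u\<close>. This
  form serves all kinds of basis vectors.\<close>

lemma seidel_entry_apply:
  assumes k: "k \<ge> 2" and u: "u \<in> verts (sunflower k)"
    and a: "\<And>i. i \<in> {1..k - 1} \<Longrightarrow> f (i, 1) = a i"
    and t: "\<And>i. i \<in> {1..k - 1} \<Longrightarrow> (\<Sum>j = 2..k. f (i, j)) = t i"
  shows "(\<Sum>x\<in>verts (sunflower k). seidel_entry u x * f x) =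
    (if snd u = 0 then (\<Sum>i = 1..k - 1. t i - a i)
     else if snd u = 1 then
       a (fst u) - 2 * t (fst u) - f (0, 0) + (\<Sum>i = 1..k - 1. t i - a i)
     else f (0, 0) + f u - 2 * a (fst u) - 2 * t (fst u) + (\<Sum>i = 1..k - 1. t i + a i))"
proof -
  have D: "(\<Sum>i = 1..k - 1. (\<Sum>j = 2..k. f (i, j)) - f (i, 1)) = (\<Sum>i = 1..k - 1. t i - a i)"
    and S: "(\<Sum>i = 1..k - 1. (\<Sum>j = 2..k. f (i, j)) + f (i, 1)) = (\<Sum>i = 1..k - 1. t i + a i)"
    by (rule sum.cong, simp, simp only: a t)+
  consider "u = (0, 0)" | i where "i \<in> {1..k - 1}" "u = (i, 1)"
    | i j where "i \<in> {1..k - 1}" "j \<in> {2..k}" "u = (i, j)"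
  proof -
    have "u = (0, 0) \<or> (fst u \<in> {1..k - 1} \<and> (snd u = 1 \<or> snd u \<in> {2..k}))"
      using u by (auto simp: sunflower_def)
    then show ?thesis
      using that by (metis prod.collapse)
  qed
  then show ?thesis
  proof cases
    case 1
    then show ?thesis
      using seidel_entry_center[OF k, of f] D by simp
  next
    case 2
    then show ?thesis
      using seidel_entry_core[OF k 2(1), of f] unfolding D a[OF 2(1)] t[OF 2(1)] by simp
  next
    case 3
    then show ?thesis
      using seidel_entry_outer[OF k 3(1,2), of f] unfolding S a[OF 3(1)] t[OF 3(1)] by simp
  qed
qed

lemma vertex_cases:
  assumes "u \<in> verts (sunflower k)"
  obtains "u = (0, 0)" | "fst u \<in> {1..k - 1}" "snd u = 1" | "fst u \<in> {1..k - 1}" "snd u \<in> {2..k}"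
  using assms by (force simp: sunflower_def)

text \<open>The symmetric vectors are the indicators of the three classes, and the sum of a Seidel
  row over a class depends only on the class of the row.\<close>

lemma seidel_entry_basis_vec_symmetric:
  assumes k: "k \<ge> 2" and u: "u \<in> verts (sunflower k)" and w: "w \<in> set symmetric_indices"
  shows "(\<Sum>x\<in>verts (sunflower k). seidel_entry u x * basis_vec k x w) =
    (\<Sum>x\<in>set symmetric_indices. basis_vec k u x * quotient_entry k x w)"
proof -
  define a t :: complex where
    "a = of_bool (w = (1, 1))" and "t = (of_nat k - 1) * of_bool (w = (1, 2))"
  have n: "of_nat (k - 1) = (of_nat k - 1 :: complex)"
    using k by (simp add: of_nat_diff)
  have sum1: "(\<Sum>i = 1..k - 1. c) = (of_nat k - 1) * c"
    and sum2: "(\<Sum>i = 2..k. c) = (of_nat k - 1) * c" for c :: complex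
    using k n by simp_all
  have A: "basis_vec k (i, 1) w = a" if "i \<in> {1..k - 1}" for i
    using w that by (auto simp: basis_vec_def a_def)
  have T: "(\<Sum>j = 2..k. basis_vec k (i, j) w) = t" if "i \<in> {1..k - 1}" for i
  proof -
    have "(\<Sum>j = 2..k. basis_vec k (i, j) w) = (\<Sum>j = 2..k. of_bool (w = (1, 2)))"
      using w that by (intro sum.cong) (auto simp: basis_vec_def)
    then show ?thesis
      unfolding t_def sum2 .
  qed
  have main: "(\<Sum>x\<in>verts (sunflower k). seidel_entry u x * basis_vec k x w) =
    (if snd u = 0 then (\<Sum>i = 1..k - 1. t - a)
     else if snd u = 1 then a - 2 * t - basis_vec k (0, 0) w + (\<Sum>i = 1..k - 1. t - a)
     else basis_vec k (0, 0) w + basis_vec k u w - 2 * a - 2 * t + (\<Sum>i = 1..k - 1. t + a))"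
    using A T by (rule seidel_entry_apply[OF k u])
  show ?thesis
    unfolding main sum1
    using u w
    by (cases rule: vertex_cases)
      (auto simp: basis_vec_def a_def t_def quotient_entry_def Let_def power2_eq_square algebra_simps)
qed

lemma sum_petal_difference:
  fixes m k :: nat
  assumes "m \<in> {2..k - 1}"
  shows "(\<Sum>i = 1..k - 1. (if i = m then 1 else if i = 1 then -1 else 0) * c) = (0 :: complex)"
proof -
  have "(\<Sum>i = 1..k - 1. if i = m then 1 else if i = 1 then -1 else 0) = (0 :: complex)"
    using assms by (subst sum_if_eq) (auto simp: sum.delta)
  then show ?thesis
    by (simp flip: sum_distrib_right)
qed

text \<open>Core values and outer sums of these vectors add up to 0 over the petals, so the sums
  over all petals drop out and a vertex sees only its own petal.\<close>

lemma seidel_entry_basis_vec_eigen: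
  assumes k: "k \<ge> 2" and u: "u \<in> verts (sunflower k)"
    and w: "w \<in> verts (sunflower k)" "w \<notin> set symmetric_indices"
  shows "(\<Sum>x\<in>verts (sunflower k). seidel_entry u x * basis_vec k x w) =
    basis_vec k u w * eigval k w"
proof (cases "snd w \<le> 2")
  case True
  then have w2: "snd w = 1 \<or> snd w = 2" and m: "fst w \<in> {2..k - 1}"
    using w by (auto simp: sunflower_def)
  define a :: "nat \<Rightarrow> complex" where
    "a = (\<lambda>i. if i = fst w then 1 else if i = 1 then -1 else 0)"
  define r where "r = eigvec_ratio k w"
  have B: "basis_vec k x w = a (fst x) * (if snd x = 1 then 1 else r)" for x
    using m True by (auto simp: basis_vec_def a_def r_def)
  have A: "basis_vec k (i, 1) w = a i" for i
    by (simp add: B)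
  have T: "(\<Sum>j = 2..k. basis_vec k (i, j) w) = (of_nat k - 1) * (a i * r)" for i
    using k by (simp add: B of_nat_diff)
  have "(of_nat k - 1) * (a i * r) - a i = a i * ((of_nat k - 1) * r - 1)"
    "(of_nat k - 1) * (a i * r) + a i = a i * ((of_nat k - 1) * r + 1)" for i
    by (simp_all add: algebra_simps)
  then have S: "(\<Sum>i = 1..k - 1. (of_nat k - 1) * (a i * r) - a i) = 0"
    "(\<Sum>i = 1..k - 1. (of_nat k - 1) * (a i * r) + a i) = 0"
    using sum_petal_difference[OF m] by (simp_all add: a_def)
  \<comment> \<open>The center has first coordinate 0, so the eigenvector vanishes there.\<close>
  have a0: "a 0 = 0"
    using m by (simp add: a_def)
  have e0: "2 * ((of_nat k - 1) * r) = 1 - eigval k w" "r * eigval k w = eigval k w - 3 + r"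
    using eigvec_ratio_eqs[OF k w2] unfolding r_def by (simp_all add: algebra_simps)
  have e: "1 - 2 * ((of_nat k - 1) * r) = eigval k w"
    "r - 2 - 2 * ((of_nat k - 1) * r) = r * eigval k w"
    unfolding e0 by simp_all
  \<comment> \<open>Both rows of the eigenvector equation, scaled by the petal weight
    \<open>c\<close>.\<close>
  have e': "c - 2 * ((of_nat k - 1) * (c * r)) = c * eigval k w"
    "c * r - 2 * c - 2 * ((of_nat k - 1) * (c * r)) = c * r * eigval k w" for c
    using arg_cong[OF e(1), of "(*) c"] arg_cong[OF e(2), of "(*) c"]
    by (simp_all add: algebra_simps)
  show ?thesis
    unfolding seidel_entry_apply[OF k u, of "\<lambda>x. basis_vec k x w", OF A T] S
    using u
    by (cases rule: vertex_cases) (auto simp: B a0 e')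
next
  case False
  then have w3: "snd w \<in> {3..k}" "fst w \<in> {1..k - 1}"
    using w by (auto simp: sunflower_def)
  then have B: "basis_vec k x w = 
      (if fst x = fst w then of_bool (snd x = snd w) - of_bool (snd x = 2) else 0)" for x
    by (auto simp: basis_vec_def)
  have A: "basis_vec k (i, 1) w = 0" for i
    using w3 by (auto simp: B)
  \<comment> \<open>The entry 1 at \<open>snd w\<close>, which is at least 3, cancels the entry -1
    at 2.\<close>
  have T: "(\<Sum>j = 2..k. basis_vec k (i, j) w) = 0" for i
    using w3 by (cases "i = fst w") (simp_all add: B sum_subtractf of_bool_def)
  show ?thesis
    unfolding seidel_entry_apply[OF k u, of "\<lambda>x. basis_vec k x w", OF A T]
    using u w3
    by (cases rule: vertex_cases) (auto simp: B eigval_def)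
qed

lemma seidel_entry_intertwined:
  assumes k: "k \<ge> 2" and u: "u \<in> verts (sunflower k)" and w: "w \<in> verts (sunflower k)"
  shows "(\<Sum>x\<in>verts (sunflower k). seidel_entry u x * basis_vec k x w) =
    (\<Sum>x\<in>verts (sunflower k). basis_vec k u x * block_entry k x w)"
proof -
  have fin: "finite (verts (sunflower k))"
    by (simp add: sunflower_def)
  show ?thesis
  proof (cases "w \<in> set symmetric_indices")
    case True
    have "set symmetric_indices \<subseteq> verts (sunflower k)"
      using k by (auto simp: sunflower_def)
    then have "(\<Sum>x\<in>verts (sunflower k). basis_vec k u x * block_entry k x w) =
      (\<Sum>x\<in>set symmetric_indices. basis_vec k u x * quotient_entry k x w)"
      using True fin unfolding block_entry_def
      by (intro sum.mono_neutral_cong_right) auto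
    then show ?thesis
      using seidel_entry_basis_vec_symmetric[OF k u True] by simp
  next
    case False
    have "(\<Sum>x\<in>verts (sunflower k). basis_vec k u x * block_entry k x w) =
      (\<Sum>x\<in>verts (sunflower k). if x = w then basis_vec k u w * eigval k w else 0)"
      using False unfolding block_entry_def by (intro sum.cong) auto
    then show ?thesis
      using seidel_entry_basis_vec_eigen[OF k u w False] w fin by simp
  qed
qed

section \<open>Linear independence of the adapted basis\<close>

text \<open>A vanishing combination is read off class by class: core vertices control
  \<open>v (m, 1) + v (m, 2)\<close>, averages over the outer vertices of a petal control the sums
  weighted by \<open>eigvec_ratio\<close>, and the remainder isolates the differences.\<close>

lemma basis_vec_independent:
  assumes k: "k \<ge> 2"
    and zero: "\<And>u. u \<in> verts (sunflower k) \<Longrightarrow> (\<Sum>x\<in>verts (sunflower k). basis_vec k u x * v x) = 0"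
    and x: "x \<in> verts (sunflower k)"
  shows "v x = 0"
proof -
  \<comment> \<open>\<open>d i\<close> collects the coefficients of the differences in petal
    \<open>i\<close>, \<open>c m i\<close> is the weight on petal \<open>i\<close> of the vectors
    indexed by \<open>(m, 1)\<close> and \<open>(m, 2)\<close>, and \<open>r m\<close> is their
    joint contribution at outer vertices.\<close>
  define d where "d = (\<lambda>i. \<Sum>j = 3..k. v (i, j))"
  define c where "c = (\<lambda>m i :: nat. if i = m then 1 else if i = 1 then -1 else 0 :: complex)"
  define r where "r = (\<lambda>m. eigvec_ratio k (m, 1) * v (m, 1) + eigvec_ratio k (m, 2) * v (m, 2))"
  have split: "(\<Sum>x\<in>verts (sunflower k). f x) =
      f (0, 0) + f (1, 1) + f (1, 2) + (\<Sum>m = 2..k - 1. f (m, 1) + f (m, 2))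
      + (\<Sum>m = 1..k - 1. \<Sum>j = 3..k. f (m, j))" for f :: "nat \<times> nat \<Rightarrow> complex"
  proof -
    have "(\<Sum>j = 2..k. f (m, j)) = f (m, 2) + (\<Sum>j = 3..k. f (m, j))" for m
      using k by (simp add: sum.atLeast_Suc_atMost numeral_3_eq_3 numeral_2_eq_2)
    moreover have "(\<Sum>m = 1..k - 1. f (m, 1) + f (m, 2)) =
        f (1, 1) + f (1, 2) + (\<Sum>m = 2..k - 1. f (m, 1) + f (m, 2))"
      using k by (simp add: sum.atLeast_Suc_atMost numeral_2_eq_2)
    ultimately show ?thesis
      unfolding sum_verts_sunflower[OF k]
      by (simp add: sum.distrib algebra_simps)
  qed
  have core: "v (1, 1) + (\<Sum>m = 2..k - 1. c m i * (v (m, 1) + v (m, 2))) = 0"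
    if "i \<in> {1..k - 1}" for i
  proof -
    have "(i, 1) \<in> verts (sunflower k)"
      using that k by (auto simp: sunflower_def)
    moreover have "(\<Sum>m = 1..k - 1. \<Sum>j = 3..k. basis_vec k (i, 1) (m, j) * v (m, j)) = 0"
      by (intro sum.neutral ballI) (auto simp: basis_vec_def)
    moreover have "(\<Sum>m = 2..k - 1. basis_vec k (i, 1) (m, 1) * v (m, 1) +
        basis_vec k (i, 1) (m, 2) * v (m, 2)) = (\<Sum>m = 2..k - 1. c m i * (v (m, 1) + v (m, 2)))"
      by (intro sum.cong) (auto simp: basis_vec_def c_def algebra_simps)
    ultimately show ?thesis
      using zero[of "(i, 1)"] unfolding split by (simp add: basis_vec_def)
  qed
  \<comment> \<open>Every difference vector of petal \<open>i\<close> has entry -1 at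
    \<open>(i, 2)\<close>, hence \<open>- d i\<close> there; a vertex with \<open>j\<close> at least
    3 meets just one of them.\<close>
  have outer: "v (1, 2) + (\<Sum>m = 2..k - 1. c m i * r m) + (if j = 2 then - d i else v (i, j)) = 0"
    if "i \<in> {1..k - 1}" "j \<in> {2..k}" for i j
  proof -
    have "(i, j) \<in> verts (sunflower k)"
      using that k by (auto simp: sunflower_def)
    have "(\<Sum>m = 1..k - 1. \<Sum>j' = 3..k. basis_vec k (i, j) (m, j') * v (m, j')) =
      (\<Sum>m = 1..k - 1. if m = i then (if j = 2 then - d i else v (i, j)) else 0)"
    proof (intro sum.cong refl)
      fix m assume "m \<in> {1..k - 1}"
      have "(\<Sum>j' = 3..k. basis_vec k (i, j) (m, j') * v (m, j')) =
        (\<Sum>j' = 3..k. if m = i then (if j = 2 then - v (m, j') else if j = j' then v (m, j') else 0) else 0)"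
        by (intro sum.cong) (auto simp: basis_vec_def)
      also have "\<dots> = (if m = i then (if j = 2 then - d i else v (i, j)) else 0)"
        using that by (auto simp: d_def sum_negf sum.delta)
      finally show "(\<Sum>j' = 3..k. basis_vec k (i, j) (m, j') * v (m, j')) =
        (if m = i then (if j = 2 then - d i else v (i, j)) else 0)" .
    qed
    also have "\<dots> = (if j = 2 then - d i else v (i, j))"
      using that by simp
    finally have inner: "(\<Sum>m = 1..k - 1. \<Sum>j' = 3..k. basis_vec k (i, j) (m, j') * v (m, j')) =
      (if j = 2 then - d i else v (i, j))" .
    have petals: "(\<Sum>m = 2..k - 1. basis_vec k (i, j) (m, 1) * v (m, 1) +
        basis_vec k (i, j) (m, 2) * v (m, 2)) = (\<Sum>m = 2..k - 1. c m i * r m)"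
      using that by (intro sum.cong) (auto simp: basis_vec_def c_def r_def algebra_simps)
    show ?thesis
      using zero[OF \<open>(i, j) \<in> verts (sunflower k)\<close>] that
      unfolding split inner petals by (simp add: basis_vec_def)
  qed
  have v00: "v (0, 0) = 0"
    using zero[of "(0, 0)"] unfolding split
    by (simp add: basis_vec_def sunflower_def)
  \<comment> \<open>Petals from 2 on give \<open>s + g i = 0\<close>; petal 1 gives that
    \<open>s\<close> minus the sum of all \<open>g m\<close> is 0, hence
    \<open>(k - 1) * s = 0\<close>. This is used once for core vertices and once for outer
    averages.\<close>
  have solve: "s = 0 \<and> (\<forall>m\<in>{2..k - 1}. g m = 0)"
    if h: "\<And>i. i \<in> {1..k - 1} \<Longrightarrow> s + (\<Sum>m = 2..k - 1. c m i * g m) = 0"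
    for s :: complex and g
  proof -
    have g: "s + g i = 0" if i: "i \<in> {2..k - 1}" for i
    proof -
      have "(\<Sum>m = 2..k - 1. c m i * g m) = (\<Sum>m = 2..k - 1. if m = i then g i else 0)"
        using i by (intro sum.cong) (auto simp: c_def)
      then show ?thesis
        using h[of i] i by simp
    qed
    have "(\<Sum>m = 2..k - 1. c m 1 * g m) = (\<Sum>m = 2..k - 1. s)"
    proof (intro sum.cong refl)
      fix m assume "m \<in> {2..k - 1}"
      then show "c m 1 * g m = s"
        using g[of m] by (simp add: c_def neg_eq_iff_add_eq_0 add.commute)
    qed
    then have "s + of_nat (k - 2) * s = 0"
      using h[of 1] k by simp
    then have "of_nat (k - 1) * s = 0"
      using k by (simp add: of_nat_diff algebra_simps)
    then have "s = 0"
      using k by simp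
    then show ?thesis
      using g by simp
  qed
  have core0: "v (1, 1) = 0" "\<And>m. m \<in> {2..k - 1} \<Longrightarrow> v (m, 1) + v (m, 2) = 0"
    using solve[of "v (1, 1)" "\<lambda>m. v (m, 1) + v (m, 2)"] core by auto
  have mean: "v (1, 2) + (\<Sum>m = 2..k - 1. c m i * r m) = 0" if i: "i \<in> {1..k - 1}" for i
  proof -
    \<comment> \<open>\<open>b\<close> is the part common to all outer vertices of petal
      \<open>i\<close>. Rows from 3 on give \<open>v (i, j) = - b\<close> and row 2 gives
      \<open>b = d i\<close>, so \<open>b = - (k - 2) * b\<close>.\<close>
    define b where "b = v (1, 2) + (\<Sum>m = 2..k - 1. c m i * r m)"
    have "b - d i = 0"
      using outer[OF i, of 2] k by (simp add: b_def)
    moreover have "v (i, j) = - b" if "j \<in> {3..k}" for j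
      using outer[OF i, of j] that by (simp add: b_def add_eq_0_iff)
    then have "d i = - (of_nat (k - 2) * b)"
      unfolding d_def by simp
    ultimately have "b + of_nat (k - 2) * b = 0"
      by simp
    then have "of_nat (k - 1) * b = 0"
      using k by (simp add: of_nat_diff algebra_simps)
    then show ?thesis
      using k by (simp add: b_def)
  qed
  have mean0: "v (1, 2) = 0" "\<And>m. m \<in> {2..k - 1} \<Longrightarrow> r m = 0"
    using solve[of "v (1, 2)" r] mean by auto
  have outer0: "v (i, j) = 0" if "i \<in> {1..k - 1}" "j \<in> {3..k}" for i j
    using outer[of i j] mean[of i] that by simp
  have petal0: "v (m, 1) = 0" "v (m, 2) = 0" if m: "m \<in> {2..k - 1}" for m
  proof -
    \<comment> \<open>The plain and the ratio-weighted sum of the two coefficients both vanish.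
      Since (k + 3)(k - 1) is positive, the eigenvalues and hence the ratios differ.\<close>
    have "eigval k (m, 1) \<noteq> eigval k (m, 2)"
      using k by (simp add: eigval_def)
    moreover have "of_nat k - 1 \<noteq> (0 :: complex)"
      using k of_nat_eq_iff[of k 1, where 'a = complex] by simp
    ultimately have ne: "eigvec_ratio k (m, 1) \<noteq> eigvec_ratio k (m, 2)"
      by (simp add: eigvec_ratio_def)
    have 2: "v (m, 2) = - v (m, 1)"
      using core0(2)[OF m] by (simp add: add_eq_0_iff)
    with mean0(2)[OF m] have "(eigvec_ratio k (m, 1) - eigvec_ratio k (m, 2)) * v (m, 1) = 0"
      by (simp add: r_def algebra_simps)
    with ne show "v (m, 1) = 0"
      by simp
    with 2 show "v (m, 2) = 0"
      by simp
  qed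
  obtain i j where ij: "x = (i, j)"
    by fastforce
  consider "x = (0, 0)" | "x = (1, 1)" | "x = (1, 2)" | "i \<in> {2..k - 1}" "j = 1"
    | "i \<in> {2..k - 1}" "j = 2" | "i \<in> {1..k - 1}" "j \<in> {3..k}"
    using x unfolding ij sunflower_def by force
  then show ?thesis
    using v00 core0(1) mean0(1) petal0 outer0 ij by cases auto
qed

section \<open>The cubic factor and the assembly of the spectrum\<close>

lemma char_poly_quotient:
  "char_poly (fun_mat (block_entry k) symmetric_indices symmetric_indices) =
    (let \<kappa> = of_nat k in
      [: - 8 + 17 * \<kappa> - 11 * \<kappa> ^ 2 + 2 * \<kappa> ^ 3, - (- 17 + 26 * \<kappa> - 12 * \<kappa> ^ 2 + 2 * \<kappa> ^ 3),
         - (6 - 5 * \<kappa> + \<kappa> ^ 2), 1 :])"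
proof -
  let ?M = "fun_mat (block_entry k) symmetric_indices symmetric_indices"
  have M: "?M \<in> carrier_mat 3 3"
    by (simp add: fun_mat_def numeral_3_eq_3)
  show ?thesis
    unfolding char_poly_def det_3[OF char_poly_matrix_closed[OF M]]
    by (simp add: char_poly_matrix_def fun_mat_def block_entry_def quotient_entry_def Let_def
        eval_nat_numeral algebra_simps)
qed

theorem theorem6p3:
  fixes k :: nat and vs :: "(nat \<times> nat) list"
  assumes "k \<ge> 2"
    and "distinct vs" and "set vs = verts (sunflower k)"
  shows "\<exists>r\<^sub>1 r\<^sub>2 r\<^sub>3 :: complex.
    (let \<kappa> = of_nat k :: complex in
       proots [: - 8 + 17 * \<kappa> - 11 * \<kappa> ^ 2 + 2 * \<kappa> ^ 3,
                 - (- 17 + 26 * \<kappa> - 12 * \<kappa> ^ 2 + 2 * \<kappa> ^ 3),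
                 - (6 - 5 * \<kappa> + \<kappa> ^ 2),
                 1 :] = {# r\<^sub>1, r\<^sub>2, r\<^sub>3 #}) \<and>
    mat_spectrum (seidel_mat (sunflower k) vs) =
      replicate_mset ((k - 1) * (k - 2)) 1
      + replicate_mset (k - 2)
          (complex_of_real (2 - real k + sqrt ((real k + 3) * (real k - 1))))
      + replicate_mset (k - 2)
          (complex_of_real (2 - real k - sqrt ((real k + 3) * (real k - 1))))
      + {# r\<^sub>1, r\<^sub>2, r\<^sub>3 #}"
proof -
  let ?V = "verts (sunflower k)" and ?T = "set symmetric_indices"
  define q where "q = char_poly (fun_mat (block_entry k) symmetric_indices symmetric_indices)"
  have deg: "degree q = 3"
    unfolding q_def char_poly_quotient Let_def by simp
  obtain rs where rs: "mset rs = proots q"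
    using ex_mset by blast
  with deg have "length rs = 3"
    by (metis size_mset size_proots_complex)
  with rs obtain r1 r2 r3 where r: "proots q = {# r1, r2, r3 #}"
    by (auto simp: numeral_3_eq_3 length_Suc_conv dest: sym)
  have "finite (?V - ?T)"
    by (simp add: sunflower_def)
  \<comment> \<open>Any order of the remaining vertices will do, since their block is
    diagonal.\<close>
  then obtain ws where ws: "set ws = ?V - ?T" "distinct ws"
    using finite_distinct_list by blast
  have T: "?T \<subseteq> ?V"
    using assms(1) by (auto simp: sunflower_def)
  let ?ws = "symmetric_indices @ ws"
  have d: "distinct ?ws" and set: "set ?ws = ?V"
    using ws T by auto
  have "char_poly (fun_mat seidel_entry vs vs) = char_poly (fun_mat (block_entry k) ?ws ?ws)"
  proof (rule char_poly_fun_mat_eq[OF assms(2) d, where p = "basis_vec k"])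
    show "length vs = length ?ws"
      using assms(2,3) d set by (metis distinct_card)
  qed (use seidel_entry_intertwined[OF assms(1)] basis_vec_independent[OF assms(1)]
      in \<open>unfold set assms(3), blast+\<close>)
  also have "\<dots> = q * (\<Prod>w\<leftarrow>ws. [:- eigval k w, 1:])"
    unfolding q_def using ws
    by (intro char_poly_block_diagonal[OF d]) (auto simp: block_entry_def)
  finally have cp: "char_poly (map_mat complex_of_real (seidel_mat (sunflower k) vs)) =
      q * (\<Prod>w\<leftarrow>ws. [:- eigval k w, 1:])"
    by (simp only: seidel_mat_sunflower[OF assms])
  have nz: "q \<noteq> 0" "(\<Prod>w\<leftarrow>ws. [:- eigval k w, 1:]) \<noteq> 0"
    using deg by (auto simp: prod_list_zero_iff)
  have const: "image_mset (eigval k) (mset_set A) = replicate_mset n l"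
    if "\<And>w. w \<in> A \<Longrightarrow> eigval k w = l" "card A = n" "finite A" for A n l
  proof -
    have "image_mset (eigval k) (mset_set A) = image_mset (\<lambda>_. l) (mset_set A)"
      using that by (intro image_mset_cong) auto
    then show ?thesis
      using that by (simp add: image_mset_const_eq)
  qed
  \<comment> \<open>Labels of the eigenvalue 1 and of the two quadratic eigenvalues.
    \<open>{3..k}\<close> and \<open>{2..k - 1}\<close> have \<open>k - 2\<close> elements each; for
    k = 2 both are empty.\<close>
  let ?A = "{1..k - 1} \<times> {3..k}" and ?B = "{2..k - 1} \<times> {1 :: nat}" and ?C = "{2..k - 1} \<times> {2 :: nat}"
  have "set ws = ?A \<union> ?B \<union> ?C"
    unfolding ws using assms(1) by (auto simp: sunflower_def)
  then have "mset ws = mset_set (?A \<union> ?B \<union> ?C)"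
    using ws(2) by (metis mset_set_set)
  also have "\<dots> = mset_set (?A \<union> ?B) + mset_set ?C"
    by (rule mset_set_Union) auto
  also have "mset_set (?A \<union> ?B) = mset_set ?A + mset_set ?B"
    by (rule mset_set_Union) auto
  finally have "image_mset (eigval k) (mset ws) =
      image_mset (eigval k) (mset_set ?A) + image_mset (eigval k) (mset_set ?B)
      + image_mset (eigval k) (mset_set ?C)"
    by simp
  also have "image_mset (eigval k) (mset_set ?A) = replicate_mset ((k - 1) * (k - 2)) 1"
    by (rule const) (auto simp: eigval_def)
  also have "image_mset (eigval k) (mset_set ?B) = replicate_mset (k - 2)
      (complex_of_real (2 - real k + sqrt ((real k + 3) * (real k - 1))))"
    by (rule const) (auto simp: eigval_def card_cartesian_product)
  also have "image_mset (eigval k) (mset_set ?C) = replicate_mset (k - 2)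
      (complex_of_real (2 - real k - sqrt ((real k + 3) * (real k - 1))))"
    by (rule const) (auto simp: eigval_def card_cartesian_product)
  finally have "mat_spectrum (seidel_mat (sunflower k) vs) =
      {# r1, r2, r3 #} + (replicate_mset ((k - 1) * (k - 2)) 1
      + replicate_mset (k - 2)
          (complex_of_real (2 - real k + sqrt ((real k + 3) * (real k - 1))))
      + replicate_mset (k - 2)
          (complex_of_real (2 - real k - sqrt ((real k + 3) * (real k - 1)))))"
    unfolding mat_spectrum_def cp proots_mult[OF nz] proots_prod_linear_factors r by simp
  moreover have "(let \<kappa> = of_nat k :: complex in
       proots [: - 8 + 17 * \<kappa> - 11 * \<kappa> ^ 2 + 2 * \<kappa> ^ 3,
                 - (- 17 + 26 * \<kappa> - 12 * \<kappa> ^ 2 + 2 * \<kappa> ^ 3),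
                 - (6 - 5 * \<kappa> + \<kappa> ^ 2),
                 1 :] = {# r1, r2, r3 #})"
    using r unfolding q_def char_poly_quotient Let_def .
  ultimately show ?thesis
    by (intro exI[of _ r1] exI[of _ r2] exI[of _ r3]) (simp only: ac_simps)
qed

end
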